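(* Let $(Q_n)_{n\ge 0}$ be the Pell-Lucas sequence. For an integer base $b$ with $2\le b\le 10$, call a positive integer $N$ a concatenation of two repdigits in base $b$ if $$N=d_1\left(\frac{b^{\ell_1}-1}{b-1}\right) b^{\ell_2}+d_2\left(\frac{b^{\ell_2}-1}{b-1}\right)$$ for some integers $\ell_1,\ell_2\ge 1$ and digits $d_1\in\{1,\dots,b-1\}$, $d_2\in\{0,1,\dots,b-1\}$ with $d_1\neq d_2$. Then the Pell-Lucas numbers $Q_n$ ($n\ge 0$) which are concatenations of two repdigits in some base $b\in\{2,\dots,10\}$ are exactly $$2,\ 6,\ 14,\ 34,\ 82.$$ For instance $2=Q_0=Q_1=\overline{10}_2$, $6=Q_2=\overline{110}_2=\overline{20}_3=\overline{12}_4=\overline{10}_6$, $14=Q_3=\overline{1110}_2=\overline{112}_3=\overline{32}_4=\overline{24}_5=\overline{20}_7=\overline{16}_8=\overline{15}_9=\overline{14}_{10}$, $34=Q_4=\overline{114}_5=\overline{54}_6=\overline{46}_7=\overline{42}_8=\overline{37}_9=\overline{34}_{10}$, $82=Q_5=\overline{122}_8=\overline{82}_{10}$, where $\overline{x_k\cdots x_0}_b$ denotes the integer with base-$b$ digits $x_k,\dots,x_0$.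
   Context: The Pell-Lucas sequence is defined by $Q_0=Q_1=2$, $Q_n=2Q_{n-1}+Q_{n-2}$ for $n\ge 2$. *)

theory Defs
  imports Complex_Main
begin

fun pell_lucas :: "nat \<Rightarrow> nat" where
  "pell_lucas 0 = 2"
| "pell_lucas (Suc 0) = 2"
| "pell_lucas (Suc (Suc n)) = 2 * pell_lucas (Suc n) + pell_lucas n"

text \<open>Division and subtraction on \<^typ>\<open>nat\<close> are exact here, since \<^term>\<open>b - 1\<close> divides
  \<^term>\<open>b ^ l - 1\<close> and \<^term>\<open>b \<ge> 2\<close>.\<close>

definition concat_two_repdigits :: "nat \<Rightarrow> nat \<Rightarrow> bool" where
  "concat_two_repdigits b N \<longleftrightarrow>
     0 < N \<and>
     (\<exists>l1 l2 d1 d2. 1 \<le> l1 \<and> 1 \<le> l2 \<and> d1 \<in> {1..b - 1} \<and> d2 \<in> {0..b - 1} \<and> d1 \<noteq> d2 \<and>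
        N = d1 * ((b ^ l1 - 1) div (b - 1)) * b ^ l2 + d2 * ((b ^ l2 - 1) div (b - 1)))"

text \<open>The list \<^term>\<open>xs\<close> of digits is written most significant digit first, whereas
  \<^const>\<open>horner_sum\<close> expects the least significant one first.\<close>

definition has_digits :: "nat \<Rightarrow> nat list \<Rightarrow> nat \<Rightarrow> bool" where
  "has_digits b xs N \<longleftrightarrow>
     xs \<noteq> [] \<and> hd xs \<noteq> 0 \<and> (\<forall>x\<in>set xs. x < b) \<and> N = horner_sum id b (rev xs)"

end

theory Submission
  imports Defs "HOL-Number_Theory.Cong"
begin

text \<open>Multiplied by \<^term>\<open>b - 1\<close>, a repdigit concatenation has the form
  \<^term>\<open>d1 * b ^ x + (d2 - d1) * b ^ y - d2\<close> with \<^term>\<open>x > y\<close>.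
  Modulo any number the Pell-Lucas sequence is periodic in the index and the powers of \<^term>\<open>b\<close>
  are eventually periodic in the exponent, so congruences restrict the residue classes of the index and of
  the exponents. All solutions have short digit blocks: if \<^term>\<open>y\<close> is not small, the equation
  modulo a power of \<^term>\<open>b\<close> pins the index down to few classes modulo a multiple of that power's
  period, and primes whose Pell period shares factors with it eliminate those classes one after the
  other. For the finitely many small \<^term>\<open>y\<close> the same sieve bounds \<^term>\<open>x\<close>, and only
  finitely many values remain. The moduli were found by a computer search.\<close>

section \<open>Pell-Lucas numbers modulo m\<close>

text \<open>\<^term>\<open>pell_pair n\<close> is the pair \<^term>\<open>(u, v)\<close> with
  \<^term>\<open>(1 + sqrt 2) ^ n = u + v * sqrt 2\<close>.\<close>

fun pell_pair :: "nat \<Rightarrow> int \<times> int" where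
  "pell_pair 0 = (1, 0)"
| "pell_pair (Suc n) = (case pell_pair n of (u, v) \<Rightarrow> (u + 2 * v, u + v))"

lemma int_pell_lucas: "int (pell_lucas n) = 2 * fst (pell_pair n)"
  by (induction n rule: pell_lucas.induct) (auto split: prod.splits)

text \<open>\<open>(1 + sqrt 2) ^ (m + n)\<close> multiplied out in Z[sqrt 2]; it yields both
  squaring and shifts by a period.\<close>

lemma pell_pair_add:
  "pell_pair (m + n) =
     (fst (pell_pair m) * fst (pell_pair n) + 2 * (snd (pell_pair m) * snd (pell_pair n)),
      fst (pell_pair m) * snd (pell_pair n) + snd (pell_pair m) * fst (pell_pair n))"
  by (induction m) (auto split: prod.splits simp: algebra_simps)

text \<open>Repeated squaring of 1 + sqrt 2 along the binary digits of the index; an odd digit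
  multiplies by 1 + sqrt 2 once more.\<close>

fun pell_pow :: "int \<Rightarrow> num \<Rightarrow> int \<times> int" where
  "pell_pow m num.One = (1 mod m, 1 mod m)"
| "pell_pow m (num.Bit0 k) =
     (case pell_pow m k of (u, v) \<Rightarrow> ((u * u + 2 * (v * v)) mod m, 2 * (u * v) mod m))"
| "pell_pow m (num.Bit1 k) =
     (case pell_pow m k of (u, v) \<Rightarrow>
       ((u * u + 2 * (v * v) + 4 * (u * v)) mod m, (u * u + 2 * (v * v) + 2 * (u * v)) mod m))"

lemma pell_pow:
  "[fst (pell_pow m k) = fst (pell_pair (numeral k))] (mod m) \<and>
   [snd (pell_pow m k) = snd (pell_pair (numeral k))] (mod m)"
proof (induction k)
  case One
  show ?case by (simp add: cong_def)
next
  case (Bit0 k)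
  obtain u v where uv: "pell_pow m k = (u, v)" by fastforce
  obtain u' v' where uv': "pell_pair (numeral k) = (u', v')" by fastforce
  have "[u = u'] (mod m)" "[v = v'] (mod m)"
    using Bit0 uv uv' by simp_all
  then have "[u * u + 2 * (v * v) = u' * u' + 2 * (v' * v')] (mod m)"
    "[2 * (u * v) = 2 * (u' * v')] (mod m)"
    by (auto intro!: cong_add cong_mult)
  moreover have "pell_pair (numeral (num.Bit0 k)) = (u' * u' + 2 * (v' * v'), 2 * (u' * v'))"
    unfolding numeral_Bit0[of k] pell_pair_add uv' by simp
  ultimately show ?case
    using uv by simp
next
  case (Bit1 k)
  obtain u v where uv: "pell_pow m k = (u, v)" by fastforce
  obtain u' v' where uv': "pell_pair (numeral k) = (u', v')" by fastforce
  have "[u = u'] (mod m)" "[v = v'] (mod m)"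
    using Bit1 uv uv' by simp_all
  then have "[u * u + 2 * (v * v) + 4 * (u * v) = u' * u' + 2 * (v' * v') + 4 * (u' * v')] (mod m)"
    "[u * u + 2 * (v * v) + 2 * (u * v) = u' * u' + 2 * (v' * v') + 2 * (u' * v')] (mod m)"
    by (auto intro!: cong_add cong_mult)
  moreover have "pell_pair (numeral (num.Bit1 k)) =
      (u' * u' + 2 * (v' * v') + 4 * (u' * v'), u' * u' + 2 * (v' * v') + 2 * (u' * v'))"
    unfolding numeral_Bit1[of k] pell_pair_add uv' by simp
  ultimately show ?case
    using uv by simp
qed

section \<open>Powers of the base modulo m\<close>

fun pow_mod :: "int \<Rightarrow> int \<Rightarrow> num \<Rightarrow> int" where
  "pow_mod m b num.One = b mod m"
| "pow_mod m b (num.Bit0 k) = (pow_mod m b k)\<^sup>2 mod m"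
| "pow_mod m b (num.Bit1 k) = (pow_mod m b k)\<^sup>2 * b mod m"

lemma pow_mod: "[pow_mod m b k = b ^ numeral k] (mod m)"
proof (induction k)
  case One
  show ?case by simp
next
  case (Bit0 k)
  have "b ^ numeral (num.Bit0 k) = (b ^ numeral k)\<^sup>2"
    unfolding numeral_Bit0[of k] power_add power2_eq_square ..
  with cong_pow[OF Bit0, of 2] show ?case
    by simp
next
  case (Bit1 k)
  have "b ^ numeral (num.Bit1 k) = (b ^ numeral k)\<^sup>2 * b"
    unfolding numeral_Bit1[of k] power_add power2_eq_square power_one_right ..
  with cong_scalar_right[OF cong_pow[OF Bit1, of 2], of b] show ?case
    by simp
qed

section \<open>Periodicity in the index and in the exponents\<close>

lemma cong_of_period:
  fixes f :: "nat \<Rightarrow> int"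
  assumes "\<And>n. [f (n + M) = f n] (mod m)" and "[n = n'] (mod M)"
  shows "[f n = f n'] (mod m)"
proof -
  have shift: "[f (n + k * M) = f n] (mod m)" for n k
  proof (induction k)
    case (Suc k)
    then show ?case
      using assms(1)[of "n + k * M"] by (auto simp: algebra_simps intro: cong_trans)
  qed simp
  have red: "[f n = f (n mod M)] (mod m)" for n
    using shift[of "n mod M" "n div M"] by simp
  show ?thesis
    using red[of n] red[of n'] assms(2) by (metis cong_def)
qed

text \<open>With \<open>(u, v)\<close> and \<open>(U, V)\<close> the pairs of \<open>n\<close> and
  \<open>M\<close>, the Pell-Lucas number of index \<open>n + M\<close> is
  \<open>u * (2 * U) + v * (4 * V)\<close>. So only \<open>2 * U\<close> and \<open>4 * V\<close>
  matter, which for even \<open>m\<close> asks less than periodicity of the pair. The factor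
  \<open>g\<close> absorbs the pre-period of the powers when \<open>m\<close> and \<open>b\<close>
  share a factor.\<close>

definition has_periods :: "int \<Rightarrow> int \<Rightarrow> int \<Rightarrow> num \<Rightarrow> num \<Rightarrow> bool" where
  "has_periods b g m M L \<longleftrightarrow>
     (2 * fst (pell_pow m M) - 2) mod m = 0 \<and> 4 * snd (pell_pow m M) mod m = 0 \<and>
     (g * pow_mod m b L - g) mod m = 0"

lemma pell_lucas_cong:
  assumes "has_periods b g m M L" and "[n = n'] (mod numeral M)"
  shows "[int (pell_lucas n) = int (pell_lucas n')] (mod m)"
proof (rule cong_of_period[OF _ assms(2)])
  fix n
  let ?u = "fst (pell_pair (numeral M))" and ?v = "snd (pell_pair (numeral M))"
  have "[2 * fst (pell_pow m M) = 2] (mod m)" "[4 * snd (pell_pow m M) = 0] (mod m)"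
    using assms(1) by (auto simp: has_periods_def cong_iff_dvd_diff)
  moreover have "[2 * ?u = 2 * fst (pell_pow m M)] (mod m)" "[4 * ?v = 4 * snd (pell_pow m M)] (mod m)"
    using pell_pow cong_sym by (blast intro: cong_scalar_left)+
  ultimately have "[2 * ?u = 2] (mod m)" "[4 * ?v = 0] (mod m)"
    by (auto simp only: cong_def)
  then have "[fst (pell_pair n) * (2 * ?u) + snd (pell_pair n) * (4 * ?v) =
      fst (pell_pair n) * 2 + snd (pell_pair n) * 0] (mod m)"
    by (intro cong_add cong_scalar_left)
  then show "[int (pell_lucas (n + numeral M)) = int (pell_lucas n)] (mod m)"
    by (simp add: int_pell_lucas pell_pair_add algebra_simps)
qed

lemma scaled_power_cong:
  assumes "has_periods b g m M L" and "[u = u'] (mod numeral L)"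
  shows "[g * b ^ u = g * b ^ u'] (mod m)"
proof (rule cong_of_period[OF _ assms(2)])
  fix u
  have "[g * pow_mod m b L = g] (mod m)"
    using assms(1) by (auto simp: has_periods_def cong_iff_dvd_diff)
  then have "[g * b ^ numeral L = g] (mod m)"
    by (rule cong_trans[OF cong_scalar_left[OF cong_sym[OF pow_mod]]])
  then have "[b ^ u * (g * b ^ numeral L) = b ^ u * g] (mod m)"
    by (rule cong_scalar_left)
  then show "[g * b ^ (u + numeral L) = g * b ^ u] (mod m)"
    by (simp add: power_add algebra_simps)
qed

section \<open>The sieve\<close>

text \<open>As \<open>num\<close> has no zero, the class of 0 modulo \<open>M\<close> is represented
  by \<open>M\<close>; starting from \<open>num.One\<close> modulo \<open>num.One\<close>,
  representatives run from 1 to the modulus.\<close>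

fun lifts :: "num \<Rightarrow> num \<Rightarrow> nat \<Rightarrow> num list" where
  "lifts r M 0 = []"
| "lifts r M (Suc q) = r # lifts (r + M) M q"

lemma set_lifts: "j < q \<Longrightarrow> \<exists>r'\<in>set (lifts r M q). numeral r' = (numeral r + j * numeral M :: nat)"
proof (induction q arbitrary: r j)
  case (Suc q)
  show ?case
  proof (cases j)
    case (Suc i)
    then obtain r' where r': "r' \<in> set (lifts (r + M) M q)"
      "numeral r' = (numeral (r + M) + i * numeral M :: nat)"
      using Suc.IH[of i "r + M"] Suc.prems by auto
    then have "numeral r' = (numeral r + j * numeral M :: nat)"
      unfolding numeral_add Suc by (simp only: mult_Suc add.assoc)
    with r'(1) show ?thesis
      by auto
  qed auto
qed simp

lemma cong_lifts:
  fixes n :: nat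
  assumes "[n = numeral r] (mod numeral M)" and "0 < q"
  shows "\<exists>r'\<in>set (lifts r M q). [n = numeral r'] (mod numeral (M * num_of_nat q))"
proof -
  \<comment> \<open>The quotient modulo \<open>q\<close> tells which lift contains \<open>n\<close>.
    It is taken over the integers because \<open>n\<close> may be smaller than the
    representative.\<close>
  define k where "k = nat ((int n - numeral r) div numeral M mod int q)"
  have k: "k < q" "int k = (int n - numeral r) div numeral M mod int q"
    using \<open>0 < q\<close> by (auto simp: k_def nat_less_iff)
  have "int n = numeral r + numeral M * ((int n - numeral r) div numeral M)"
    using assms(1) by (simp add: cong_int_iff[symmetric] cong_iff_dvd_diff)
  moreover obtain i where "(int n - numeral r) div numeral M = int k + int q * i"
    using k(2) by (metis mult_div_mod_eq add.commute)
  ultimately have "int n - (numeral r + int k * numeral M) = (numeral M * int q) * i"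
    by (simp add: algebra_simps)
  then have "[int n = int (numeral r + k * numeral M)] (mod int (numeral M * q))"
    by (simp add: cong_iff_dvd_diff)
  then have "[n = numeral r + k * numeral M] (mod (numeral M * q))"
    by (simp only: cong_int_iff)
  moreover have "(numeral (M * num_of_nat q) :: nat) = numeral M * q"
    using \<open>0 < q\<close> by (simp add: numeral_mult numeral_num_of_nat del: numeral_times_numeral)
  ultimately show ?thesis
    using set_lifts[OF k(1), of r M] by auto
qed

text \<open>The summands of the equation are tabulated per variable, so that the search over triples
  only adds. The constant joins the index term; \<open>d\<close> will be \<open>2 * (b - 1)\<close>,
  as a Pell-Lucas number is twice the first component of its pair.\<close>

fun pell_terms :: "int \<Rightarrow> int \<Rightarrow> int \<Rightarrow> num list \<Rightarrow> (num \<times> int) list" where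
  "pell_terms m d c [] = []"
| "pell_terms m d c (r # rs) = (r, (c - d * fst (pell_pow m r)) mod m) # pell_terms m d c rs"

fun pow_terms :: "int \<Rightarrow> int \<Rightarrow> int \<Rightarrow> num list \<Rightarrow> (num \<times> int) list" where
  "pow_terms m b a [] = []"
| "pow_terms m b a (s # ss) = (s, a * pow_mod m b s mod m) # pow_terms m b a ss"

lemma set_pell_terms:
  "set (pell_terms m d c rs) = (\<lambda>r. (r, (c - d * fst (pell_pow m r)) mod m)) ` set rs"
  by (induction rs) auto

lemma set_pow_terms: "set (pow_terms m b a ss) = (\<lambda>s. (s, a * pow_mod m b s mod m)) ` set ss"
  by (induction ss) auto

text \<open>A state \<^term>\<open>((A, B, C), r, s, t)\<close> stands for the solutions of
  \<^term>\<open>(b - 1) * int (pell_lucas n) = A * (g * b ^ u) + B * (g * b ^ v) + C\<close> whose index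
  \<^term>\<open>n\<close> lies in the class of \<^term>\<open>r\<close> and whose exponents \<^term>\<open>u\<close>, \<^term>\<open>v\<close>
  lie in the classes of \<^term>\<open>s\<close>, \<^term>\<open>t\<close>. Here \<^term>\<open>g\<close> is a fixed power of
  \<^term>\<open>b\<close>, so that moduli dividing \<^term>\<open>g\<close> are available.\<close>

type_synonym state = "(int \<times> int \<times> int) \<times> num \<times> num \<times> num"

text \<open>Plain recursion instead of list comprehensions, since \<^emph>\<open>code_simp\<close> also rewrites under binders,
  which makes comprehensions slow.\<close>

fun select_t :: "int \<Rightarrow> int \<times> int \<times> int \<Rightarrow> num \<Rightarrow> num \<Rightarrow> int \<Rightarrow> (num \<times> int) list \<Rightarrow> state list" where
  "select_t m c r s x [] = []"
| "select_t m c r s x ((t, z) # Z) =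
     (if (x + z) mod m = 0 then (c, r, s, t) # select_t m c r s x Z else select_t m c r s x Z)"

fun select_s ::
  "int \<Rightarrow> int \<times> int \<times> int \<Rightarrow> num \<Rightarrow> int \<Rightarrow> (num \<times> int) list \<Rightarrow> (num \<times> int) list \<Rightarrow> state list" where
  "select_s m c r x Z [] = []"
| "select_s m c r x Z ((s, y) # Y) = select_t m c r s (x + y) Z @ select_s m c r x Z Y"

fun select ::
  "int \<Rightarrow> int \<times> int \<times> int \<Rightarrow> (num \<times> int) list \<Rightarrow> (num \<times> int) list \<Rightarrow> (num \<times> int) list \<Rightarrow> state list" where
  "select m c Z Y [] = []"
| "select m c Z Y ((r, x) # X) = select_s m c r x Z Y @ select m c Z Y X"

lemma select_tI: "(t, z) \<in> set Z \<Longrightarrow> m dvd x + z \<Longrightarrow> (c, r, s, t) \<in> set (select_t m c r s x Z)"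
  by (induction Z) auto

lemma select_sI:
  "(t, z) \<in> set Z \<Longrightarrow> (s, y) \<in> set Y \<Longrightarrow> m dvd x + y + z \<Longrightarrow>
   (c, r, s, t) \<in> set (select_s m c r x Z Y)"
  by (induction Y) (auto intro: select_tI)

lemma selectI:
  "(t, z) \<in> set Z \<Longrightarrow> (s, y) \<in> set Y \<Longrightarrow> (r, x) \<in> set X \<Longrightarrow> m dvd x + y + z \<Longrightarrow>
   (c, r, s, t) \<in> set (select m c Z Y X)"
  by (induction X) (auto intro: select_sI)

text \<open>For \<open>B = 0\<close> the second exponent does not occur, so one dummy entry
  contributing 0 replaces its \<open>q\<close> lifts.\<close>

fun sieve_step :: "int \<Rightarrow> int \<Rightarrow> int \<Rightarrow> num \<Rightarrow> nat \<Rightarrow> num \<Rightarrow> nat \<Rightarrow> state list \<Rightarrow> state list" where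
  "sieve_step b g m M p L q [] = []"
| "sieve_step b g m M p L q (((A, B, C), r, s, t) # S) =
     select m (A, B, C)
       (if B = 0 then [(t, 0)] else pow_terms m b (B * g) (lifts t L q))
       (pow_terms m b (A * g) (lifts s L q))
       (pell_terms m (2 * (b - 1)) C (lifts r M p)) @
     sieve_step b g m M p L q S"

lemma sieve_stepI:
  assumes "((A, B, C), r, s, t) \<in> set S"
    and "x \<in> set (select m (A, B, C)
       (if B = 0 then [(t, 0)] else pow_terms m b (B * g) (lifts t L q))
       (pow_terms m b (A * g) (lifts s L q))
       (pell_terms m (2 * (b - 1)) C (lifts r M p)))"
  shows "x \<in> set (sieve_step b g m M p L q S)"
  using assms by (induction S) auto

text \<open>A certificate entry \<^term>\<open>(p, q, m)\<close> multiplies the modulus of the index by \<^term>\<open>p\<close> and that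
  of the exponents by \<^term>\<open>q\<close>, and then discards the classes without solutions modulo \<^term>\<open>m\<close>.\<close>

fun refutes :: "int \<Rightarrow> int \<Rightarrow> num \<Rightarrow> num \<Rightarrow> state list \<Rightarrow> (nat \<times> nat \<times> int) list \<Rightarrow> bool" where
  "refutes b g M L S [] \<longleftrightarrow> S = []"
| "refutes b g M L S ((p, q, m) # cs) \<longleftrightarrow>
     0 < p \<and> 0 < q \<and> has_periods b g m (M * num_of_nat p) (L * num_of_nat q) \<and>
     refutes b g (M * num_of_nat p) (L * num_of_nat q) (sieve_step b g m M p L q S) cs"

text \<open>The class of a solution survives every step, passing to one of its lifts, so a list that
  ends empty admits no solution.\<close>

lemma refutes_sound:
  assumes "refutes b g M L S cs" and "((A, B, C), r, s, t) \<in> set S"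
    and "[n = numeral r] (mod numeral M)" and "[u = numeral s] (mod numeral L)"
    and "B = 0 \<or> [v = numeral t] (mod numeral L)"
  shows "(b - 1) * int (pell_lucas n) \<noteq> A * (g * b ^ u) + B * (g * b ^ v) + C"
  using assms
proof (induction cs arbitrary: M L S r s t)
  case Nil
  then show ?case by simp
next
  case (Cons c cs)
  obtain p q m where c: "c = (p, q, m)"
    by (cases c)
  let ?M = "M * num_of_nat p" and ?L = "L * num_of_nat q"
  from Cons.prems c have pos: "0 < p" "0 < q" and per: "has_periods b g m ?M ?L"
    and rest: "refutes b g ?M ?L (sieve_step b g m M p L q S) cs"
    by auto
  obtain r' where r': "r' \<in> set (lifts r M p)" "[n = numeral r'] (mod numeral ?M)"
    using cong_lifts[OF Cons.prems(3) pos(1)] by blast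
  obtain s' where s': "s' \<in> set (lifts s L q)" "[u = numeral s'] (mod numeral ?L)"
    using cong_lifts[OF Cons.prems(4) pos(2)] by blast
  obtain t' where t': "B = 0 \<and> t' = t \<or> B \<noteq> 0 \<and> t' \<in> set (lifts t L q) \<and> [v = numeral t'] (mod numeral ?L)"
    using cong_lifts[OF _ pos(2), of v t L] Cons.prems(5) by blast
  show ?case
  proof
    assume eq: "(b - 1) * int (pell_lucas n) = A * (g * b ^ u) + B * (g * b ^ v) + C"
    define x where "x = (C - 2 * (b - 1) * fst (pell_pow m r')) mod m"
    define y where "y = A * g * pow_mod m b s' mod m"
    define z where "z = (if B = 0 then 0 else B * g * pow_mod m b t' mod m)"
    have "[int (pell_lucas n) = 2 * fst (pell_pair (numeral r'))] (mod m)"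
      using pell_lucas_cong[OF per r'(2)] by (simp add: int_pell_lucas)
    then have "[int (pell_lucas n) = 2 * fst (pell_pow m r')] (mod m)"
      by (rule cong_trans) (intro cong_scalar_left cong_sym[OF conjunct1[OF pell_pow]])
    then have "[C - (b - 1) * int (pell_lucas n) = C - (b - 1) * (2 * fst (pell_pow m r'))] (mod m)"
      by (intro cong_diff cong_refl cong_scalar_left)
    then have x: "[x = C - (b - 1) * int (pell_lucas n)] (mod m)"
      by (simp add: x_def cong_def algebra_simps)
    have pw: "[a * g * pow_mod m b k = a * (g * b ^ i)] (mod m)"
      if "[i = numeral k] (mod numeral ?L)" for a k i
    proof -
      have "[g * pow_mod m b k = g * b ^ numeral k] (mod m)"
        by (intro cong_scalar_left pow_mod)
      then have "[g * pow_mod m b k = g * b ^ i] (mod m)"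
        by (rule cong_trans) (rule cong_sym[OF scaled_power_cong[OF per that]])
      then show ?thesis
        by (simp add: cong_scalar_left mult.assoc)
    qed
    have y: "[y = A * (g * b ^ u)] (mod m)"
      using pw[OF s'(2), of A] by (simp add: y_def cong_def)
    have z: "[z = B * (g * b ^ v)] (mod m)"
      using t' pw[of v t' B] by (auto simp: z_def cong_def)
    \<comment> \<open>Modulo \<open>m\<close> this sum is the right side of the equation minus the
      left.\<close>
    have "[x + y + z = C - (b - 1) * int (pell_lucas n) + A * (g * b ^ u) + B * (g * b ^ v)] (mod m)"
      using x y z by (intro cong_add)
    then have sum: "m dvd x + y + z"
      using eq by (simp add: cong_dvd_iff)
    have "((A, B, C), r', s', t') \<in> set (sieve_step b g m M p L q S)"
    proof (rule sieve_stepI[OF Cons.prems(2)], rule selectI[OF _ _ _ sum])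
      show "(t', z) \<in> set (if B = 0 then [(t, 0)] else pow_terms m b (B * g) (lifts t L q))"
        using t' by (auto simp: z_def set_pow_terms)
      show "(s', y) \<in> set (pow_terms m b (A * g) (lifts s L q))"
        using s' by (auto simp: y_def set_pow_terms)
      show "(r', x) \<in> set (pell_terms m (2 * (b - 1)) C (lifts r M p))"
        using r' by (auto simp: x_def set_pell_terms)
    qed
    moreover have "B = 0 \<or> [v = numeral t'] (mod numeral ?L)"
      using t' by blast
    ultimately show False
      using Cons.IH[OF rest _ r'(2) s'(2)] eq by blast
  qed
qed

section \<open>Repdigit concatenations\<close>

lemma concat_two_repdigits_eq:
  assumes "2 \<le> b"
    and "N = d1 * ((b ^ l1 - 1) div (b - 1)) * b ^ l2 + d2 * ((b ^ l2 - 1) div (b - 1))"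
  shows "(int b - 1) * int N = int d1 * int b ^ (l1 + l2) + (int d2 - int d1) * int b ^ l2 - int d2"
proof -
  have rep: "(int b - 1) * int ((b ^ l - 1) div (b - 1)) = int b ^ l - 1" for l
  proof -
    have "(b - 1) * ((b ^ l - 1) div (b - 1)) = b ^ l - 1"
    proof (rule dvd_mult_div_cancel)
      \<comment> \<open>Writing 1 as \<open>1 ^ l\<close> makes the factorisation of a difference of
        \<open>l\<close>-th powers applicable.\<close>
      have "int b - 1 dvd int b ^ l - 1 ^ l"
        by (metis dvd_triv_left power_diff_sumr2)
      then show "b - 1 dvd b ^ l - 1"
        using assms(1) by (simp add: of_nat_diff flip: int_dvd_int_iff)
    qed
    then have "int (b - 1) * int ((b ^ l - 1) div (b - 1)) = int (b ^ l - 1)"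
      by (metis of_nat_mult)
    then show ?thesis
      using assms(1) by (simp add: of_nat_diff)
  qed
  have "(int b - 1) * int N =
      int d1 * ((int b - 1) * int ((b ^ l1 - 1) div (b - 1))) * int b ^ l2 +
      int d2 * ((int b - 1) * int ((b ^ l2 - 1) div (b - 1)))"
    unfolding assms(2) by (simp add: algebra_simps)
  then show ?thesis
    unfolding rep by (simp add: algebra_simps power_add)
qed

text \<open>The long states cover lower blocks of length at least \<^term>\<open>Y\<close>, the short ones lower blocks
  of fixed length \<^term>\<open>y < Y\<close> in numbers with at least \<^term>\<open>X\<close> digits.\<close>

definition long_states :: "int \<Rightarrow> state list" where
  "long_states b =
     [((d1, d2 - d1, - d2), num.One, num.One, num.One). d1 \<leftarrow> [1..b - 1], d2 \<leftarrow> [0..b - 1], d1 \<noteq> d2]"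

definition short_states :: "int \<Rightarrow> nat \<Rightarrow> state list" where
  "short_states b Y =
     [((d1, 0, (d2 - d1) * b ^ y - d2), num.One, num.One, num.One).
       d1 \<leftarrow> [1..b - 1], d2 \<leftarrow> [0..b - 1], d1 \<noteq> d2, y \<leftarrow> [1..<Y]]"

text \<open>What both sieves leave over. Here \<open>x\<close> is the total length, so it starts at
  \<open>Suc y\<close> because the upper block is nonempty.\<close>

definition small_values :: "int \<Rightarrow> nat \<Rightarrow> nat \<Rightarrow> int list" where
  "small_values b X Y =
     [d1 * b ^ x + (d2 - d1) * b ^ y - d2.
       d1 \<leftarrow> [1..b - 1], d2 \<leftarrow> [0..b - 1], d1 \<noteq> d2, y \<leftarrow> [1..<Y], x \<leftarrow> [Suc y..<X]]"

text \<open>The list consists of the Pell-Lucas numbers of index 6 to 13; the next one is 228486.\<close>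

definition no_large_pell_lucas :: "int \<Rightarrow> int \<Rightarrow> bool" where
  "no_large_pell_lucas d V \<longleftrightarrow>
     V < d * 228486 \<and> V \<notin> set (map ((*) d) [198, 478, 1154, 2786, 6726, 16238, 39202, 94642])"

section \<open>Comparison with the first Pell-Lucas numbers\<close>

lemma pell_lucas_values:
  shows "pell_lucas 2 = 6"
    and "pell_lucas 3 = 14"
    and "pell_lucas 4 = 34"
    and "pell_lucas 5 = 82"
    and "pell_lucas 6 = 198"
    and "pell_lucas 7 = 478"
    and "pell_lucas 8 = 1154"
    and "pell_lucas 9 = 2786"
    and "pell_lucas 10 = 6726"
    and "pell_lucas 11 = 16238"
    and "pell_lucas 12 = 39202"
    and "pell_lucas 13 = 94642"
    and "pell_lucas 14 = 228486"
proof -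
  have rec: "pell_lucas n = 2 * pell_lucas (n - 1) + pell_lucas (n - 2)" if "2 \<le> n" for n
    using that by (cases n rule: pell_lucas.cases) auto
  show v2: "pell_lucas 2 = 6"
    using rec[of 2] by simp
  show v3: "pell_lucas 3 = 14"
    using rec[of 3] v2 by simp
  show v4: "pell_lucas 4 = 34"
    using rec[of 4] v3 v2 by simp
  show v5: "pell_lucas 5 = 82"
    using rec[of 5] v4 v3 by simp
  show v6: "pell_lucas 6 = 198"
    using rec[of 6] v5 v4 by simp
  show v7: "pell_lucas 7 = 478"
    using rec[of 7] v6 v5 by simp
  show v8: "pell_lucas 8 = 1154"
    using rec[of 8] v7 v6 by simp
  show v9: "pell_lucas 9 = 2786"
    using rec[of 9] v8 v7 by simp
  show v10: "pell_lucas 10 = 6726"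
    using rec[of 10] v9 v8 by simp
  show v11: "pell_lucas 11 = 16238"
    using rec[of 11] v10 v9 by simp
  show v12: "pell_lucas 12 = 39202"
    using rec[of 12] v11 v10 by simp
  show v13: "pell_lucas 13 = 94642"
    using rec[of 13] v12 v11 by simp
  show v14: "pell_lucas 14 = 228486"
    using rec[of 14] v13 v12 by simp
qed

lemma pell_lucas_mono:
  assumes "m \<le> n"
  shows "pell_lucas m \<le> pell_lucas n"
proof -
  have "pell_lucas k \<le> pell_lucas (Suc k)" for k
    by (cases k) auto
  then show ?thesis
    using assms by (rule lift_Suc_mono_le)
qed

lemma no_large_pell_lucas:
  assumes "no_large_pell_lucas d V" and "d * int (pell_lucas n) = V" and "0 < d"
  shows "n \<le> 5"
proof (rule ccontr)
  assume "\<not> n \<le> 5"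
  then consider "n \<in> {6, 7, 8, 9, 10, 11, 12, 13}" | "14 \<le> n"
    by force
  then show False
  proof cases
    case 1
    with assms show False
      by (auto simp: no_large_pell_lucas_def pell_lucas_values)
  next
    case 2
    then have "228486 \<le> int (pell_lucas n)"
      using pell_lucas_mono[OF 2] by (simp add: pell_lucas_values)
    with \<open>0 < d\<close> have "d * 228486 \<le> d * int (pell_lucas n)"
      by (simp add: mult_left_mono)
    with assms show False
      by (simp add: no_large_pell_lucas_def)
  qed
qed

text \<open>Either the lower block is long, or it is short in a long number, or both lengths are
  bounded. The sieve excludes the first two cases; the third is a finite check.\<close>

lemma pell_lucas_concat_le_5:
  assumes conc: "concat_two_repdigits b (pell_lucas n)" and b: "2 \<le> b"
    and long: "refutes (int b) (int b ^ Y) num.One num.One (long_states (int b)) cs"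
    and short: "refutes (int b) (int b ^ X) num.One num.One (short_states (int b) Y) cs'"
    and small: "list_all (no_large_pell_lucas (int b - 1)) (small_values (int b) X Y)"
  shows "n \<le> 5"
proof -
  from conc obtain l1 l2 d1 d2 where l: "1 \<le> l1" "1 \<le> l2"
    and d: "d1 \<in> {1..b - 1}" "d2 \<in> {0..b - 1}" "d1 \<noteq> d2"
    and N: "pell_lucas n =
      d1 * ((b ^ l1 - 1) div (b - 1)) * b ^ l2 + d2 * ((b ^ l2 - 1) div (b - 1))"
    unfolding concat_two_repdigits_def by blast
  note eq = concat_two_repdigits_eq[OF b N]
  have d': "int d1 \<in> {1..int b - 1}" "int d2 \<in> {0..int b - 1}" "int d1 \<noteq> int d2"
    using d b by auto
  \<comment> \<open>The sieve starts from the only class modulo 1.\<close>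
  have one: "[k = numeral num.One] (mod numeral num.One)" for k :: nat
    by simp
  have "l2 < Y"
  proof (rule ccontr)
    assume "\<not> l2 < Y"
    \<comment> \<open>Both exponents are at least \<open>Y\<close>, so \<open>g = b ^ Y\<close>
      splits off both powers.\<close>
    then have pw: "int b ^ (l1 + l2) = int b ^ Y * int b ^ (l1 + l2 - Y)" "int b ^ l2 = int b ^ Y * int b ^ (l2 - Y)"
      by (simp_all flip: power_add)
    have "((int d1, int d2 - int d1, - int d2), num.One, num.One, num.One) \<in> set (long_states (int b))"
      using d' by (force simp: long_states_def)
    from refutes_sound[OF long this one one disjI2[OF one], of n "l1 + l2 - Y" "l2 - Y"] eq
    show False unfolding pw by simp
  qed
  have "l1 + l2 < X"
  proof (rule ccontr)
    assume "\<not> l1 + l2 < X"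
    \<comment> \<open>Only the leading power is split; the other one has fixed exponent
      \<open>l2\<close> and belongs to the constant.\<close>
    then have pw: "int b ^ (l1 + l2) = int b ^ X * int b ^ (l1 + l2 - X)"
      by (simp flip: power_add)
    have "((int d1, 0, (int d2 - int d1) * int b ^ l2 - int d2), num.One, num.One, num.One)
        \<in> set (short_states (int b) Y)"
      using d' l \<open>l2 < Y\<close> by (force simp: short_states_def)
    \<comment> \<open>The final \<open>0\<close> is a placeholder exponent whose power is multiplied
      by \<open>B = 0\<close>.\<close>
    from refutes_sound[OF short this one one disjI1[OF refl], of n "l1 + l2 - X" 0] eq
    show False unfolding pw by simp
  qed
  have "int d1 * int b ^ (l1 + l2) + (int d2 - int d1) * int b ^ l2 - int d2
      \<in> set (small_values (int b) X Y)"
    using d' l \<open>l2 < Y\<close> \<open>l1 + l2 < X\<close> by (force simp: small_values_def)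
  with small eq b show ?thesis
    by (auto simp: list_all_iff intro: no_large_pell_lucas)
qed

section \<open>Certificates\<close>

text \<open>The only digit pair is (1, 0), so the right side vanishes modulo 4, whereas every
  Pell-Lucas number is 2 modulo 4.\<close>

lemma long_refuted_2:
  "refutes 2 (2 ^ 2) num.One num.One (long_states 2)
     [(1, 1, 4)]"
  by code_simp

text \<open>The bounds \<open>Y = 2\<close> and \<open>X = 5\<close> are least possible, since 14 is
  1110 in base 2, with lower block of length 1 and total length 4.\<close>

lemma short_refuted_2:
  "refutes 2 (2 ^ 5) num.One num.One (short_states 2 2)
     [(4, 1, 16), (2, 1, 32), (1, 2, 3)]"
  by code_simp

lemma small_values_2: "list_all (no_large_pell_lucas (2 - 1)) (small_values 2 5 2)"
  by code_simp

text \<open>The moduli 3, 9, 27, 81 divide \<open>g\<close>, so there both powers vanish and only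
  the index and \<open>d2\<close> are constrained. The coprime moduli bring in \<open>d1\<close> and
  the exponents.\<close>

lemma long_refuted_3:
  "refutes 3 (3 ^ 4) num.One num.One (long_states 3)
     [(8, 1, 3), (3, 1, 9), (1, 2, 8), (1, 2, 5), (1, 1, 16), (3, 1, 27), (1, 3, 7), (1, 1,
      73), (3, 1, 81), (1, 5, 11), (5, 1, 31), (1, 1, 271)]"
  by code_simp

lemma short_refuted_3:
  "refutes 3 (3 ^ 4) num.One num.One (short_states 3 4)
     [(1, 2, 4), (4, 1, 8), (2, 1, 3), (3, 1, 9), (1, 2, 5), (1, 1, 16), (1, 3, 7), (3, 1,
      27), (1, 1, 73), (3, 1, 81), (1, 5, 11), (5, 1, 31), (1, 1, 271)]"
  by code_simp

lemma small_values_3: "list_all (no_large_pell_lucas (3 - 1)) (small_values 3 4 4)"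
  by code_simp

lemma long_refuted_4:
  "refutes 4 (4 ^ 2) num.One num.One (long_states 4)
     [(4, 1, 16)]"
  by code_simp

lemma short_refuted_4:
  "refutes 4 (4 ^ 3) num.One num.One (short_states 4 2)
     [(4, 1, 16), (2, 1, 32), (2, 1, 64), (1, 4, 17)]"
  by code_simp

lemma small_values_4: "list_all (no_large_pell_lucas (4 - 1)) (small_values 4 3 2)"
  by code_simp

lemma long_refuted_5:
  "refutes 5 (5 ^ 3) num.One num.One (long_states 5)
     [(12, 1, 5), (5, 1, 25), (1, 3, 31), (1, 2, 7), (1, 1, 8), (2, 1, 9), (1, 2, 16), (1,
      1, 601), (5, 1, 125), (1, 5, 41), (1, 1, 11), (1, 5, 151)]"
  by code_simp

lemma short_refuted_5:
  "refutes 5 (5 ^ 4) num.One num.One (short_states 5 3)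
     [(12, 1, 5), (1, 2, 8), (1, 3, 7), (2, 1, 9), (5, 1, 31), (1, 1, 25), (5, 1, 125), (1,
      5, 11), (1, 5, 151), (1, 5, 751), (5, 1, 625), (1, 1, 3001)]"
  by code_simp

lemma small_values_5: "list_all (no_large_pell_lucas (5 - 1)) (small_values 5 4 3)"
  by code_simp

lemma long_refuted_6:
  "refutes 6 (6 ^ 3) num.One num.One (long_states 6)
     [(4, 1, 8), (2, 1, 3), (3, 1, 9), (3, 1, 27), (1, 2, 7), (1, 7, 197), (5, 1, 29)]"
  by code_simp

lemma short_refuted_6:
  "refutes 6 (6 ^ 5) num.One num.One (short_states 6 3)
     [(4, 1, 16), (2, 1, 32), (1, 1, 3), (3, 1, 9), (1, 2, 7)]"
  by code_simp

lemma small_values_6: "list_all (no_large_pell_lucas (6 - 1)) (small_values 6 5 3)"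
  by code_simp

lemma long_refuted_7:
  "refutes 7 (7 ^ 3) num.One num.One (long_states 7)
     [(6, 1, 7), (7, 1, 49), (1, 2, 4), (2, 1, 16), (1, 2, 5), (1, 3, 13), (2, 1, 9), (1, 1,
      32), (5, 1, 19), (1, 1, 25), (1, 7, 29), (1, 1, 113), (1, 2, 337), (3, 1, 73), (7, 1,
      343), (1, 7, 197), (1, 1, 3529)]"
  by code_simp

lemma short_refuted_7:
  "refutes 7 (7 ^ 4) num.One num.One (short_states 7 3)
     [(1, 2, 4), (4, 1, 16), (3, 1, 7), (7, 1, 49), (1, 2, 5), (1, 3, 13), (2, 1, 9), (1, 7,
      113), (1, 2, 337), (3, 1, 73), (1, 7, 197), (7, 1, 343), (1, 1, 3529)]"
  by code_simp

lemma small_values_7: "list_all (no_large_pell_lucas (7 - 1)) (small_values 7 4 3)"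
  by code_simp

lemma long_refuted_8:
  "refutes 8 (8 ^ 3) num.One num.One (long_states 8)
     [(4, 1, 16), (2, 1, 32), (1, 2, 3), (3, 1, 9), (1, 2, 5), (2, 1, 64), (1, 2, 17), (2,
      1, 128), (1, 2, 97)]"
  by code_simp

lemma short_refuted_8:
  "refutes 8 (8 ^ 4) num.One num.One (short_states 8 3)
     [(4, 1, 16), (2, 1, 32), (1, 2, 3), (2, 1, 64), (1, 4, 17), (3, 1, 5), (1, 1, 9), (2,
      1, 128), (1, 2, 97), (4, 1, 512), (1, 2, 193), (2, 1, 1024), (1, 4, 769)]"
  by code_simp

lemma small_values_8: "list_all (no_large_pell_lucas (8 - 1)) (small_values 8 4 3)"
  by code_simp

lemma long_refuted_9:
  "refutes 9 (9 ^ 2) num.One num.One (long_states 9)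
     [(8, 1, 3), (3, 1, 9), (1, 2, 5), (1, 1, 16), (3, 1, 27), (1, 3, 73), (1, 1, 7), (3, 1,
      81), (1, 5, 11), (5, 1, 31), (1, 1, 271)]"
  by code_simp

lemma short_refuted_9:
  "refutes 9 (9 ^ 4) num.One num.One (short_states 9 2)
     [(8, 1, 3), (1, 2, 16), (3, 1, 5), (1, 1, 9), (1, 3, 7), (3, 1, 73), (1, 1, 27), (1, 5,
      11), (5, 1, 31), (3, 1, 81), (1, 1, 271), (1, 2, 32), (2, 1, 241), (1, 3, 19), (1, 3,
      433), (3, 1, 243), (1, 3, 3889), (3, 1, 729)]"
  by code_simp

lemma small_values_9: "list_all (no_large_pell_lucas (9 - 1)) (small_values 9 4 2)"
  by code_simp

text \<open>All moduli divide \<open>10 ^ 3\<close>: no Pell-Lucas number is congruent modulo 1000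
  to a block of three equal digits.\<close>

lemma long_refuted_10:
  "refutes 10 (10 ^ 3) num.One num.One (long_states 10)
     [(4, 1, 8), (3, 1, 5), (5, 1, 25)]"
  by code_simp

lemma short_refuted_10:
  "refutes 10 (10 ^ 6) num.One num.One (short_states 10 3)
     [(4, 1, 16), (3, 1, 5), (2, 1, 32), (1, 2, 11), (2, 1, 64), (1, 8, 17), (3, 1, 73)]"
  by code_simp

lemma small_values_10: "list_all (no_large_pell_lucas (10 - 1)) (small_values 10 6 3)"
  by code_simp

section \<open>All bases together, and the theorem\<close>

lemma pell_lucas_concat_imp_le_5:
  assumes "b \<in> {2..10}" and "concat_two_repdigits b (pell_lucas n)"
  shows "n \<le> 5"
proof -
  from assms(1) consider "b = 2" | "b = 3" | "b = 4" | "b = 5" | "b = 6" | "b = 7" | "b = 8"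
    | "b = 9" | "b = 10"
    by force
  then show ?thesis
  proof cases
    case 1
    with assms(2) show ?thesis
      \<comment> \<open>The unfolding turns \<open>int b\<close> into the integer numeral of the
        certificates.\<close>
      using pell_lucas_concat_le_5[of 2 n, unfolded of_nat_numeral,
          OF _ _ long_refuted_2 short_refuted_2 small_values_2] by simp
  next
    case 2
    with assms(2) show ?thesis
      using pell_lucas_concat_le_5[of 3 n, unfolded of_nat_numeral,
          OF _ _ long_refuted_3 short_refuted_3 small_values_3] by simp
  next
    case 3
    with assms(2) show ?thesis
      using pell_lucas_concat_le_5[of 4 n, unfolded of_nat_numeral,
          OF _ _ long_refuted_4 short_refuted_4 small_values_4] by simp
  next
    case 4
    with assms(2) show ?thesis
      using pell_lucas_concat_le_5[of 5 n, unfolded of_nat_numeral,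
          OF _ _ long_refuted_5 short_refuted_5 small_values_5] by simp
  next
    case 5
    with assms(2) show ?thesis
      using pell_lucas_concat_le_5[of 6 n, unfolded of_nat_numeral,
          OF _ _ long_refuted_6 short_refuted_6 small_values_6] by simp
  next
    case 6
    with assms(2) show ?thesis
      using pell_lucas_concat_le_5[of 7 n, unfolded of_nat_numeral,
          OF _ _ long_refuted_7 short_refuted_7 small_values_7] by simp
  next
    case 7
    with assms(2) show ?thesis
      using pell_lucas_concat_le_5[of 8 n, unfolded of_nat_numeral,
          OF _ _ long_refuted_8 short_refuted_8 small_values_8] by simp
  next
    case 8
    with assms(2) show ?thesis
      using pell_lucas_concat_le_5[of 9 n, unfolded of_nat_numeral,
          OF _ _ long_refuted_9 short_refuted_9 small_values_9] by simp
  next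
    case 9
    with assms(2) show ?thesis
      using pell_lucas_concat_le_5[of 10 n, unfolded of_nat_numeral,
          OF _ _ long_refuted_10 short_refuted_10 small_values_10] by simp
  qed
qed

theorem theorem1p2:
  shows "{pell_lucas n | n. \<exists>b\<in>{2..10}. concat_two_repdigits b (pell_lucas n)} = {2, 6, 14, 34, 82} \<and>
    (2 = pell_lucas 0 \<and> 2 = pell_lucas 1 \<and> has_digits 2 [1,0] 2) \<and>
    (6 = pell_lucas 2 \<and> has_digits 2 [1,1,0] 6 \<and> has_digits 3 [2,0] 6 \<and>
       has_digits 4 [1,2] 6 \<and> has_digits 6 [1,0] 6) \<and>
    (14 = pell_lucas 3 \<and> has_digits 2 [1,1,1,0] 14 \<and> has_digits 3 [1,1,2] 14 \<and>
       has_digits 4 [3,2] 14 \<and> has_digits 5 [2,4] 14 \<and> has_digits 7 [2,0] 14 \<and>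
       has_digits 8 [1,6] 14 \<and> has_digits 9 [1,5] 14 \<and> has_digits 10 [1,4] 14) \<and>
    (34 = pell_lucas 4 \<and> has_digits 5 [1,1,4] 34 \<and> has_digits 6 [5,4] 34 \<and>
       has_digits 7 [4,6] 34 \<and> has_digits 8 [4,2] 34 \<and> has_digits 9 [3,7] 34 \<and>
       has_digits 10 [3,4] 34) \<and>
    (82 = pell_lucas 5 \<and> has_digits 8 [1,2,2] 82 \<and> has_digits 10 [8,2] 82)"
proof -
  \<comment> \<open>As a \<open>foldr\<close>, the Horner sum simplifies on concrete digit
    lists.\<close>
  have digits: "has_digits b xs N \<longleftrightarrow>
      xs \<noteq> [] \<and> hd xs \<noteq> 0 \<and> (\<forall>x\<in>set xs. x < b) \<and> N = foldr (\<lambda>x y. x + b * y) (rev xs) 0" for b xs N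
    by (simp add: has_digits_def horner_sum_foldr)
  \<comment> \<open>Both blocks have length one.\<close>
  have two_digits: "concat_two_repdigits b (d1 * b + d2)"
    if "d1 \<in> {1..b - 1}" "d2 \<in> {0..b - 1}" "d1 \<noteq> d2" "2 \<le> b" for b d1 d2
    unfolding concat_two_repdigits_def using that
    by (intro conjI exI[of _ 1] exI[of _ d1] exI[of _ d2]) auto
  \<comment> \<open>One base per value suffices; 2 and 6 need a small base, being single digits in
    base 10.\<close>
  have "concat_two_repdigits 2 2" "concat_two_repdigits 4 6" "concat_two_repdigits 10 14"
    "concat_two_repdigits 10 34" "concat_two_repdigits 10 82"
    using two_digits[of 1 2 0] two_digits[of 1 4 2] two_digits[of 1 10 4]
      two_digits[of 3 10 4] two_digits[of 8 10 2] by simp_all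
  then have conc: "\<exists>b\<in>{2..10}. concat_two_repdigits b N" if "N \<in> {2, 6, 14, 34, 82}" for N
    using that by (auto intro: bexI[of _ 2] bexI[of _ 4] bexI[of _ 10])
  have range: "{2, 6, 14, 34, 82} \<subseteq> range pell_lucas"
    using pell_lucas_values(1-4) pell_lucas.simps(1) by (metis empty_subsetI insert_subset rangeI)
  have small: "pell_lucas n \<in> {2, 6, 14, 34, 82}" if "n \<le> 5" for n
  proof -
    from that consider "n = 0" | "n = 1" | "n = 2" | "n = 3" | "n = 4" | "n = 5"
      by force
    then show ?thesis
      by cases (simp_all add: pell_lucas_values)
  qed
  have "{pell_lucas n | n. \<exists>b\<in>{2..10}. concat_two_repdigits b (pell_lucas n)} = {2, 6, 14, 34, 82}"
    (is "?L = ?R")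
  proof
    show "?L \<subseteq> ?R"
      using small pell_lucas_concat_imp_le_5 by fast
    show "?R \<subseteq> ?L"
    proof
      fix N :: nat
      assume N: "N \<in> ?R"
      with range obtain n where "N = pell_lucas n"
        by auto
      with conc[OF N] show "N \<in> ?L"
        by auto
    qed
  qed
  then show ?thesis
    by (simp add: pell_lucas_values digits)
qed

end
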